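(* For every $q$ with $0<q<1$, the function $$\mathcal{F}_q(x)=[\psi_q'(x)-\ln q]^2+\psi_q''(x)$$ is completely monotonic on $(0,\infty)$; and for every $q>1$, the function $$\mathfrak{F}_q(x)=[\psi_q'(x)]^2+\psi_q''(x)$$ is completely monotonic on $(0,\infty)$. Here $\psi_q$ is the $q$-digamma function and primes denote derivatives with respect to $x$.
   Context: A function $f$ is completely monotonic on an interval $I$ if $f$ has derivatives of all orders on $I$ and $0\le(-1)^{n}f^{(n)}(x)<\infty$ for all $x\in I$ and all integers $n\ge0$. For $x>0$ the $q$-gamma function is defined by $$\Gamma_q(x)=(1-q)^{1-x}\prod_{i=0}^\infty\frac{1-q^{i+1}}{1-q^{i+x}}\quad\text{for }0<q<1,$$ $$\Gamma_q(x)=(q-1)^{1-x}q^{\binom{x}{2}}\prod_{i=0}^\infty\frac{1-q^{-(i+1)}}{1-q^{-(i+x)}}\quad\text{for }q>1,$$ where $\binom{x}{2}=\frac{x(x-1)}{2}$. For $q>0$, $q\neq1$ and $x>0$, the $q$-digamma function is $\psi_q(x)=\Gamma_q'(x)/\Gamma_q(x)$ (derivative in $x$). Its derivatives $\psi_q'$ and $\psi_q''$ are the $q$-trigamma and $q$-tetragamma functions. Explicitly, for $x>0$: $\psi_q(x)=-\ln(1-q)+(\ln q)\sum_{k=1}^\infty\frac{q^{kx}}{1-q^{k}}$ when $0<q<1$, and $\psi_q(x)=-\ln(q-1)+(\ln q)\Bigl[x-\frac12-\sum_{i=1}^\infty\frac{q^{-ix}}{1-q^{-i}}\Bigr]$ when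 $q>1$. *)

theory Defs
  imports "HOL-Analysis.Analysis"
begin

text \<open>
  The family \<open>D\<close> collects the successive derivatives of \<open>f\<close>; at an endpoint belonging to \<open>I\<close>
  they are one-sided. On an interval with more than one point the values of \<open>D\<close> on \<open>I\<close> are
  uniquely determined by \<open>f\<close>.
\<close>

definition completely_monotonic_on :: "real set \<Rightarrow> (real \<Rightarrow> real) \<Rightarrow> bool" where
  "completely_monotonic_on I f \<longleftrightarrow>
     (\<exists>D :: nat \<Rightarrow> real \<Rightarrow> real.
        (\<forall>x\<in>I. D 0 x = f x) \<and>
        (\<forall>n. \<forall>x\<in>I. (D n has_real_derivative D (Suc n) x) (at x within I)) \<and>
        (\<forall>n. \<forall>x\<in>I. 0 \<le> (-1) ^ n * D n x))"

lemma completely_monotonic_on_open_iff: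
  assumes "open I"
  shows "completely_monotonic_on I f \<longleftrightarrow>
    (\<forall>n. \<forall>x\<in>I. (deriv ^^ n) f differentiable (at x) \<and> 0 \<le> (-1) ^ n * (deriv ^^ n) f x)"
    (is "?L \<longleftrightarrow> ?R")
proof
  assume ?L
  then obtain D where D0: "\<And>x. x \<in> I \<Longrightarrow> D 0 x = f x"
    and DS: "\<And>n x. x \<in> I \<Longrightarrow> (D n has_real_derivative D (Suc n) x) (at x within I)"
    and Dn: "\<And>n x. x \<in> I \<Longrightarrow> 0 \<le> (-1) ^ n * D n x"
    unfolding completely_monotonic_on_def by blast
  have der: "((deriv ^^ n) f has_real_derivative D (Suc n) x) (at x)"
    if eq: "\<And>y. y \<in> I \<Longrightarrow> D n y = (deriv ^^ n) f y" and x: "x \<in> I" for n x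
    using has_field_derivative_transform_within_open[OF _ assms x eq]
      DS[OF x, of n] at_within_open[OF x assms] by simp
  have eq: "\<And>x. x \<in> I \<Longrightarrow> D n x = (deriv ^^ n) f x" for n
  proof (induction n)
    case 0
    then show ?case by (simp add: D0)
  next
    case (Suc n)
    show ?case using DERIV_imp_deriv[OF der[OF Suc.IH Suc.prems]] by simp
  qed
  show ?R
    using der[OF eq] Dn eq by (metis real_differentiable_def)
next
  assume R: ?R
  have "((deriv ^^ n) f has_real_derivative (deriv ^^ Suc n) f x) (at x within I)"
    if "x \<in> I" for n x
  proof -
    from R that have "(deriv ^^ n) f differentiable (at x)" by blast
    then show ?thesis
      by (metis DERIV_imp_deriv comp_apply funpow.simps(2) has_field_derivative_at_within
          real_differentiable_def)
  qed
  with R show ?L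
    unfolding completely_monotonic_on_def by (intro exI[of _ "\<lambda>n. (deriv ^^ n) f"]) auto
qed

text \<open>Only meant for \<open>q > 0\<close>, \<open>q \<noteq> 1\<close> and \<open>x > 0\<close>.\<close>

definition q_gamma :: "real \<Rightarrow> real \<Rightarrow> real" where
  "q_gamma q x =
     (if q < 1 then
        (1 - q) powr (1 - x) *
        (\<Prod>i. (1 - q powr (real i + 1)) / (1 - q powr (real i + x)))
      else
        (q - 1) powr (1 - x) * q powr (x * (x - 1) / 2) *
        (\<Prod>i. (1 - q powr (- (real i + 1))) / (1 - q powr (- (real i + x)))))"

definition q_digamma :: "real \<Rightarrow> real \<Rightarrow> real" where
  "q_digamma q x = deriv (q_gamma q) x / q_gamma q x"

definition q_trigamma :: "real \<Rightarrow> real \<Rightarrow> real" where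
  "q_trigamma q = deriv (q_digamma q)"

definition q_tetragamma :: "real \<Rightarrow> real \<Rightarrow> real" where
  "q_tetragamma q = deriv (q_trigamma q)"

end

theory Submission
  imports Defs
begin

text \<open>
  Let \<open>L = \<bar>ln q\<bar>\<close> and \<open>r = exp (- L) < 1\<close>. The function
  \<open>H t = (\<Sum>k\<ge>1. t ^ k / (k * (1 - r ^ k)))\<close> satisfies \<open>H t - H (r * t) = - ln (1 - t)\<close>, so the
  logarithm of the infinite product in \<open>\<Gamma>\<^sub>q x\<close> telescopes to \<open>H (exp (- L * x)) - H r\<close>
  (\<open>minus_ln_sums_log_coeff\<close>). Hence on both sides of \<open>q = 1\<close> the function \<open>ln \<Gamma>\<^sub>q x\<close> is a
  polynomial of degree at most two in \<open>x\<close> plus a power series in \<open>exp (- L * x)\<close>, and it can be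
  differentiated termwise.

  The quadratic term is present only for \<open>q > 1\<close>, where it adds \<open>ln q\<close> to \<open>\<psi>\<^sub>q'\<close>; for \<open>q < 1\<close> the
  same quantity is supplied by the summand \<open>- ln q\<close>. So both functions of the theorem equal
  \<open>(L + S)\<^sup>2 + S'\<close> with \<open>S = (\<Sum>k\<ge>1. L\<^sup>2 * k / (1 - r ^ k) * exp (- L * x) ^ k)\<close>. Writing
  \<open>T u = u / (1 - exp (- u))\<close> and \<open>T 0 = 1\<close>, we have
  \<open>L + S = L * (\<Sum>k\<ge>0. T (k * L) * exp (- L * x) ^ k)\<close>, where the constant \<open>L\<close> has become
  the term \<open>k = 0\<close>. The coefficient of \<open>exp (- L * x) ^ n\<close> in \<open>(L + S)\<^sup>2 + S'\<close> is therefore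
  \<open>L\<^sup>2 * ((\<Sum>j\<le>n. T (j * L) * T ((n - j) * L)) - n * T (n * L))\<close>. Since
  \<open>T u * T v \<ge> T (u + v)\<close> for \<open>u, v \<ge> 0\<close> (\<open>todd_supermult\<close>), each of the \<open>n + 1\<close> summands is at
  least \<open>T (n * L)\<close>, and the coefficient is nonnegative. A series in \<open>exp (- L * x)\<close> with
  nonnegative coefficients is completely monotonic.
\<close>

section \<open>Power series in a decaying exponential\<close>

text \<open>
  Convergence is demanded on the whole open disc, and not only at one \<open>t\<close>, because this is stable
  under termwise differentiation and Cauchy products.
\<close>

definition disc_summable :: "(nat \<Rightarrow> real) \<Rightarrow> bool" where
  "disc_summable c \<longleftrightarrow> (\<forall>t. \<bar>t\<bar> < 1 \<longrightarrow> summable (\<lambda>k. c k * t ^ k))"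

definition exp_series :: "real \<Rightarrow> (nat \<Rightarrow> real) \<Rightarrow> real \<Rightarrow> real" where
  "exp_series L c x = (\<Sum>k. c k * exp (- (L * x)) ^ k)"

definition deriv_coeff :: "real \<Rightarrow> (nat \<Rightarrow> real) \<Rightarrow> nat \<Rightarrow> real" where
  "deriv_coeff L c k = - (L * real k) * c k"

lemma disc_summable_cmult: "disc_summable c \<Longrightarrow> disc_summable (\<lambda>k. a * c k)"
  unfolding disc_summable_def by (auto simp: mult.assoc intro!: summable_mult)

lemma disc_summable_add:
  "disc_summable c \<Longrightarrow> disc_summable d \<Longrightarrow> disc_summable (\<lambda>k. c k + d k)"
  unfolding disc_summable_def by (auto simp: distrib_right intro!: summable_add)

lemma sums_index_mult:
  assumes "disc_summable c" "\<bar>t\<bar> < 1"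
  shows "(\<lambda>k. real k * c k * t ^ k) sums (t * (\<Sum>k. diffs c k * t ^ k))"
proof -
  have "summable (\<lambda>k. diffs c k * t ^ k)"
    using termdiff_converges[of t 1 c] assms unfolding disc_summable_def by auto
  from sums_mult[OF diffs_equiv[OF this], of t]
  have "(\<lambda>k. t * (real k * c k * t ^ (k - Suc 0))) sums (t * (\<Sum>k. diffs c k * t ^ k))" .
  moreover have "t * (real k * c k * t ^ (k - Suc 0)) = real k * c k * t ^ k" for k
    by (cases k) auto
  ultimately show ?thesis by simp
qed

lemma disc_summable_deriv_coeff:
  assumes "disc_summable c"
  shows "disc_summable (deriv_coeff L c)"
proof -
  have "disc_summable (\<lambda>k. real k * c k)"
    using sums_index_mult[OF assms] unfolding disc_summable_def sums_iff by auto
  from disc_summable_cmult[OF this, of "- L"] show ?thesis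
    by (simp add: deriv_coeff_def[abs_def] mult.assoc)
qed

lemma exp_decay_less_1: "0 < L \<Longrightarrow> 0 < x \<Longrightarrow> \<bar>exp (- (L * x))\<bar> < (1::real)"
  by simp

lemma exp_series_summable:
  "disc_summable c \<Longrightarrow> 0 < L \<Longrightarrow> 0 < x \<Longrightarrow> summable (\<lambda>k. c k * exp (- (L * x)) ^ k)"
  using exp_decay_less_1[of L x] unfolding disc_summable_def by blast

lemma exp_series_add:
  "disc_summable c \<Longrightarrow> disc_summable d \<Longrightarrow> 0 < L \<Longrightarrow> 0 < x \<Longrightarrow>
    exp_series L (\<lambda>k. c k + d k) x = exp_series L c x + exp_series L d x"
  unfolding exp_series_def
  by (simp add: distrib_right suminf_add exp_series_summable)

lemma Cauchy_product_disc_sums: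
  assumes "disc_summable c" "disc_summable d" "\<bar>t\<bar> < 1"
  shows "(\<lambda>n. (\<Sum>j\<le>n. c j * d (n - j)) * t ^ n) sums
    ((\<Sum>k. c k * t ^ k) * (\<Sum>k. d k * t ^ k))"
proof -
  (* Convergence at a point s of larger modulus gives absolute convergence at t. *)
  obtain s where s: "\<bar>t\<bar> < s" "s < 1" using assms(3) dense by blast
  have abs: "summable (\<lambda>k. norm (e k * t ^ k))" if "disc_summable e" for e
    using that s unfolding disc_summable_def by (intro powser_insidea[of e s]) auto
  have "(\<Sum>j\<le>n. (c j * t ^ j) * (d (n - j) * t ^ (n - j))) = (\<Sum>j\<le>n. c j * d (n - j)) * t ^ n"
    for n
    unfolding sum_distrib_right
  proof (rule sum.cong[OF refl])
    fix j assume "j \<in> {..n}"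
    then have "t ^ j * t ^ (n - j) = t ^ n" by (simp flip: power_add)
    then show "(c j * t ^ j) * (d (n - j) * t ^ (n - j)) = c j * d (n - j) * t ^ n"
      by (metis mult.assoc mult.left_commute)
  qed
  with Cauchy_product_sums[OF abs[OF assms(1)] abs[OF assms(2)]] show ?thesis by simp
qed

lemma disc_summable_Cauchy_product:
  "disc_summable c \<Longrightarrow> disc_summable d \<Longrightarrow> disc_summable (\<lambda>n. \<Sum>j\<le>n. c j * d (n - j))"
  using Cauchy_product_disc_sums unfolding disc_summable_def[of "\<lambda>n. \<Sum>j\<le>n. c j * d (n - j)"]
  by (blast intro: sums_summable)

lemma exp_series_mult:
  assumes "disc_summable c" "disc_summable d" "0 < L" "0 < x"
  shows "exp_series L c x * exp_series L d x = exp_series L (\<lambda>n. \<Sum>j\<le>n. c j * d (n - j)) x"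
  using sums_unique[OF Cauchy_product_disc_sums[OF assms(1,2) exp_decay_less_1[OF assms(3,4)]]]
  unfolding exp_series_def by simp

lemma exp_series_has_derivative:
  assumes "disc_summable c" "0 < L" "0 < x"
  shows "(exp_series L c has_real_derivative exp_series L (deriv_coeff L c) x) (at x)"
proof -
  let ?t = "exp (- (L * x))"
  have "((\<lambda>t. \<Sum>k. c k * t ^ k) has_real_derivative (\<Sum>k. diffs c k * ?t ^ k)) (at ?t)"
    using assms exp_decay_less_1[of L x] unfolding disc_summable_def
    by (intro termdiffs_strong'[of 1]) auto
  moreover have "((\<lambda>x. exp (- (L * x))) has_real_derivative - L * ?t) (at x)"
    by (auto intro!: derivative_eq_intros)
  ultimately have "((\<lambda>x. \<Sum>k. c k * exp (- (L * x)) ^ k) has_real_derivative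
      (\<Sum>k. diffs c k * ?t ^ k) * (- L * ?t)) (at x)"
    by (rule DERIV_chain2)
  moreover have "exp_series L (deriv_coeff L c) x = (\<Sum>k. diffs c k * ?t ^ k) * (- L * ?t)"
    using sums_mult[OF sums_index_mult[OF assms(1) exp_decay_less_1[OF assms(2,3)]], of "- L"]
    unfolding exp_series_def deriv_coeff_def sums_iff by (simp add: mult_ac)
  ultimately show ?thesis unfolding exp_series_def[abs_def] by simp
qed

lemma completely_monotonic_exp_series:
  assumes "disc_summable c" "0 < L" and nonneg: "\<And>k. 0 \<le> c k"
  shows "completely_monotonic_on {0<..} (exp_series L c)"
  unfolding completely_monotonic_on_def
proof (intro exI[of _ "\<lambda>n. exp_series L ((deriv_coeff L ^^ n) c)"] conjI ballI allI)
  have summ: "disc_summable ((deriv_coeff L ^^ n) c)" for n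
    by (induction n) (auto intro: assms disc_summable_deriv_coeff)
  fix n x assume x: "x \<in> {0::real<..}"
  then show "(exp_series L ((deriv_coeff L ^^ n) c) has_real_derivative
      exp_series L ((deriv_coeff L ^^ Suc n) c) x) (at x within {0<..})"
    using exp_series_has_derivative[OF summ] \<open>0 < L\<close> by (auto intro: has_field_derivative_at_within)
  have "(-1) ^ n * (deriv_coeff L ^^ n) c k = (L * real k) ^ n * c k" for k
    by (induction n) (auto simp: deriv_coeff_def mult_ac)
  then have "0 \<le> (-1) ^ n * ((deriv_coeff L ^^ n) c k * exp (- (L * x)) ^ k)" for k
    using nonneg[of k] \<open>0 < L\<close> by (simp add: mult.assoc[symmetric])
  then show "0 \<le> (-1) ^ n * exp_series L ((deriv_coeff L ^^ n) c) x"
    using x \<open>0 < L\<close> unfolding exp_series_def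
    by (subst suminf_mult[symmetric])
      (auto intro!: exp_series_summable summ suminf_nonneg summable_mult)
qed simp

lemma completely_monotonic_on_cong:
  assumes "\<And>x. x \<in> I \<Longrightarrow> f x = g x"
  shows "completely_monotonic_on I f \<longleftrightarrow> completely_monotonic_on I g"
  using assms unfolding completely_monotonic_on_def by simp

section \<open>Supermultiplicativity of the Todd function\<close>

definition todd :: "real \<Rightarrow> real" where
  "todd u = (if u = 0 then 1 else u / (1 - exp (- u)))"

text \<open>
  This is \<open>tanh (u / 2) \<le> u / 2\<close> with denominators cleared; the difference of the two sides
  has derivative \<open>1 - (1 + u) * exp (- u) \<ge> 0\<close>.
\<close>

lemma exp_tanh_bound:
  fixes u :: real
  assumes "0 \<le> u"
  shows "2 * (1 - exp (- u)) \<le> u * (1 + exp (- u))"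
proof -
  define g where "g u = u * (1 + exp (- u)) - 2 * (1 - exp (- u))" for u :: real
  have "g 0 \<le> g u"
  proof (rule DERIV_nonneg_imp_nondecreasing[OF assms])
    fix v :: real assume "0 \<le> v"
    have "(g has_real_derivative 1 - (1 + v) * exp (- v)) (at v)"
      unfolding g_def by (auto intro!: derivative_eq_intros simp: algebra_simps)
    moreover have "(1 + v) * exp (- v) \<le> exp v * exp (- v)"
      by (intro mult_right_mono exp_ge_add_one_self) auto
    ultimately show "\<exists>y. (g has_real_derivative y) (at v) \<and> 0 \<le> y"
      by (auto simp flip: exp_add)
  qed
  then show ?thesis by (simp add: g_def)
qed

text \<open>
  With \<open>A = 1 - exp (- u)\<close> and \<open>B = 1 - exp (- v)\<close> one has \<open>1 - exp (- (u + v)) = A + B - A * B\<close>,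
  so the claim reads \<open>1 / A + 1 / B - 1 \<ge> 1 / u + 1 / v\<close>. It is the sum of the inequalities
  \<open>1 / A - 1 / 2 \<ge> 1 / u\<close> and \<open>1 / B - 1 / 2 \<ge> 1 / v\<close> of lemma \<open>exp_tanh_bound\<close>.
\<close>

lemma todd_supermult:
  assumes "0 \<le> u" "0 \<le> v"
  shows "todd (u + v) \<le> todd u * todd v"
proof (cases "u = 0 \<or> v = 0")
  case True
  then show ?thesis by (auto simp: todd_def)
next
  case False
  with assms have u: "0 < u" and v: "0 < v" by auto
  define A where "A = 1 - exp (- u)"
  define B where "B = 1 - exp (- v)"
  have A: "0 < A" and B: "0 < B" using u v by (auto simp: A_def B_def)
  have AB: "1 - exp (- (u + v)) = A + B - A * B"
    by (simp add: A_def B_def algebra_simps flip: exp_add)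
  have pos: "0 < A + B - A * B" using u v by (simp flip: AB)
  have "0 \<le> v * B * (u * (2 - A) - 2 * A) + u * A * (v * (2 - B) - 2 * B)"
    using exp_tanh_bound[of u] exp_tanh_bound[of v] u v A B by (simp add: A_def B_def)
  also have "\<dots> = 2 * (u * v * (A + B - A * B) - (u + v) * (A * B))"
    by (simp add: algebra_simps)
  finally have "(u + v) * (A * B) \<le> u * v * (A + B - A * B)" by simp
  then have "(u + v) / (A + B - A * B) \<le> u * v / (A * B)"
    using A B pos by (simp add: divide_le_eq le_divide_eq)
  moreover have "todd (u + v) = (u + v) / (A + B - A * B)"
    unfolding todd_def AB using u v by simp
  moreover have "todd u = u / A" "todd v = v / B"
    using u v by (auto simp: todd_def A_def B_def)
  ultimately show ?thesis by simp
qed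

lemma todd_pos: "0 \<le> u \<Longrightarrow> 0 < todd u"
  by (auto simp: todd_def)

text \<open>By supermultiplicativity each of the \<open>n + 1\<close> summands is at least \<open>todd (L * n)\<close>.\<close>

lemma todd_convolution_bound:
  assumes "0 \<le> L"
  shows "real n * todd (L * real n) \<le> (\<Sum>j\<le>n. todd (L * real j) * todd (L * real (n - j)))"
proof -
  have "todd (L * real n) \<le> todd (L * real j) * todd (L * real (n - j))" if "j \<le> n" for j
    using todd_supermult[of "L * real j" "L * real (n - j)"] assms that
    by (simp flip: distrib_left of_nat_add)
  then have "(\<Sum>j\<le>n. todd (L * real n)) \<le> (\<Sum>j\<le>n. todd (L * real j) * todd (L * real (n - j)))"
    by (intro sum_mono) auto
  moreover have "(\<Sum>j\<le>n. todd (L * real n)) = (real n + 1) * todd (L * real n)" by simp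
  ultimately show ?thesis
    using todd_pos[of "L * real n"] assms by (simp add: distrib_right)
qed

section \<open>The logarithm of the infinite product\<close>

text \<open>At \<open>k = 0\<close> the value is \<open>1 / 0 = 0\<close>, which is the constant coefficient wanted here.\<close>

definition log_coeff :: "real \<Rightarrow> nat \<Rightarrow> real" where
  "log_coeff L k = 1 / (real k * (1 - exp (- L) ^ k))"

lemma disc_summable_log_coeff:
  assumes "0 < L"
  shows "disc_summable (log_coeff L)"
  unfolding disc_summable_def
proof (intro allI impI)
  fix t :: real assume t: "\<bar>t\<bar> < 1"
  let ?r = "exp (- L)"
  have r: "0 < ?r" "?r < 1" using assms by auto
  have bound: "norm (log_coeff L k * t ^ k) \<le> 1 / (1 - ?r) * \<bar>t\<bar> ^ k" for k
  proof (cases "k = 0")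
    case False
    have "?r ^ k \<le> ?r ^ 1" using r False by (intro power_decreasing) auto
    then have "1 * (1 - ?r) \<le> real k * (1 - ?r ^ k)"
      using False r by (intro mult_mono) auto
    then have "\<bar>log_coeff L k\<bar> \<le> 1 / (1 - ?r)"
      using r unfolding log_coeff_def by (simp add: frac_le)
    then have "\<bar>log_coeff L k\<bar> * \<bar>t\<bar> ^ k \<le> 1 / (1 - ?r) * \<bar>t\<bar> ^ k"
      by (rule mult_right_mono) simp
    then show ?thesis by (simp add: abs_mult power_abs)
  qed (use r in \<open>simp add: log_coeff_def\<close>)
  have "summable (\<lambda>k. 1 / (1 - ?r) * \<bar>t\<bar> ^ k)"
    using t by (intro summable_mult summable_geometric) auto
  then show "summable (\<lambda>k. log_coeff L k * t ^ k)"
    by (rule summable_comparison_test'[OF _ bound])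
qed

text \<open>
  Shifting \<open>x\<close> by one multiplies the \<open>k\<close>-th term of the series by \<open>exp (- L) ^ k\<close>. In the
  difference this cancels the denominator \<open>1 - exp (- L) ^ k\<close> and leaves the Mercator series.
\<close>

lemma exp_series_log_coeff_diff:
  assumes "0 < L" "0 < x"
  shows "exp_series L (log_coeff L) x - exp_series L (log_coeff L) (x + 1)
    = - ln (1 - exp (- (L * x)))"
proof -
  let ?t = "exp (- (L * x))" and ?r = "exp (- L)"
  have shift: "exp (- (L * (x + 1))) = ?t * ?r" by (simp add: distrib_left flip: exp_add)
  have "log_coeff L k * ?t ^ k - log_coeff L k * (?t * ?r) ^ k = ?t ^ k / real k" for k
  proof (cases "k = 0")
    case False
    have "?r ^ k < 1" using assms False by (auto intro: power_less_one_iff[THEN iffD2])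
    have "log_coeff L k * ?t ^ k - log_coeff L k * (?t * ?r) ^ k
        = log_coeff L k * (1 - ?r ^ k) * ?t ^ k"
      by (simp add: algebra_simps power_mult_distrib)
    also have "log_coeff L k * (1 - ?r ^ k) = 1 / real k"
      using False \<open>?r ^ k < 1\<close> by (simp add: log_coeff_def)
    finally show ?thesis by simp
  qed (simp add: log_coeff_def)
  moreover have "(\<lambda>k. log_coeff L k * ?t ^ k - log_coeff L k * (?t * ?r) ^ k) sums
      (exp_series L (log_coeff L) x - exp_series L (log_coeff L) (x + 1))"
    using assms disc_summable_log_coeff[OF assms(1)] exp_series_summable[of "log_coeff L" L "x + 1"]
    unfolding exp_series_def shift
    by (intro sums_diff summable_sums) (auto intro!: exp_series_summable)
  moreover have "(\<lambda>k. ?t ^ k / real k) sums (- ln (1 - ?t))"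
    using sums_minus[OF ln_series'[of "- ?t"]] assms by simp
  ultimately show ?thesis by (simp add: sums_iff)
qed

lemma exp_series_shift_tendsto:
  assumes "disc_summable c" "0 < L"
  shows "(\<lambda>i. exp_series L c (x + real i)) \<longlonglongrightarrow> c 0"
proof -
  have "isCont (\<lambda>t. \<Sum>k. c k * t ^ k) 0"
    using assms(1) unfolding disc_summable_def by (intro isCont_powser[of _ "1 / 2"]) auto
  moreover have "(\<lambda>i. exp (- (L * (x + real i)))) \<longlonglongrightarrow> 0"
  proof -
    have "(\<lambda>i. exp (- (L * x)) * exp (- L) ^ i) \<longlonglongrightarrow> exp (- (L * x)) * 0"
      using assms by (intro tendsto_mult_left LIMSEQ_power_zero) auto
    moreover have "exp (- (L * (x + real i))) = exp (- (L * x)) * exp (- L) ^ i" for i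
      by (simp add: distrib_left mult_ac flip: exp_add exp_of_nat_mult)
    ultimately show ?thesis by simp
  qed
  ultimately have "(\<lambda>i. \<Sum>k. c k * exp (- (L * (x + real i))) ^ k) \<longlonglongrightarrow> (\<Sum>k. c k * 0 ^ k)"
    by (rule isCont_tendsto_compose)
  then show ?thesis by (simp add: exp_series_def)
qed

lemma minus_ln_sums_log_coeff:
  assumes "0 < L" "0 < x"
  shows "(\<lambda>i. - ln (1 - exp (- (L * (real i + x))))) sums exp_series L (log_coeff L) x"
proof -
  have "(\<lambda>i. exp_series L (log_coeff L) (x + real i)) \<longlonglongrightarrow> 0"
    using exp_series_shift_tendsto[OF disc_summable_log_coeff[OF assms(1)] assms(1)]
    by (simp add: log_coeff_def)
  from telescope_sums'[OF this] show ?thesis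
    using exp_series_log_coeff_diff[OF assms(1), of "x + real _"] assms
    by (simp add: add_ac)
qed

lemma prodinf_q_gamma:
  assumes "0 < L" "0 < x"
  shows "(\<Prod>i. (1 - exp (- (L * (real i + 1)))) / (1 - exp (- (L * (real i + x)))))
    = exp (exp_series L (log_coeff L) x - exp_series L (log_coeff L) 1)"
proof -
  let ?f = "\<lambda>i. - ln (1 - exp (- (L * (real i + x)))) - - ln (1 - exp (- (L * (real i + 1))))"
  have s: "?f sums (exp_series L (log_coeff L) x - exp_series L (log_coeff L) 1)"
    by (rule sums_diff[OF minus_ln_sums_log_coeff[OF assms]
          minus_ln_sums_log_coeff[OF assms(1) zero_less_one]])
  have "exp (?f i) = (1 - exp (- (L * (real i + 1)))) / (1 - exp (- (L * (real i + x))))" for i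
  proof -
    have "0 < 1 - exp (- (L * (real i + 1)))" "0 < 1 - exp (- (L * (real i + x)))"
      using assms by simp_all
    then show ?thesis by (simp add: exp_diff exp_minus divide_simps)
  qed
  with prodinf_exp[of ?f] s show ?thesis by (simp add: sums_iff)
qed

section \<open>The polygamma functions as exponential series\<close>

lemma q_gamma_less_1:
  assumes "0 < q" "q < 1" "0 < x"
  shows "q_gamma q x = exp ((ln (1 - q) - exp_series (- ln q) (log_coeff (- ln q)) 1)
    + - ln (1 - q) * x + 0 / 2 * x\<^sup>2 + exp_series (- ln q) (log_coeff (- ln q)) x)"
proof -
  have "q powr y = exp (- (- ln q * y))" for y
    using assms by (simp add: powr_def mult.commute)
  then have "q_gamma q x = (1 - q) powr (1 - x) *
      exp (exp_series (- ln q) (log_coeff (- ln q)) x - exp_series (- ln q) (log_coeff (- ln q)) 1)"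
    using assms prodinf_q_gamma[of "- ln q" x] by (simp add: q_gamma_def)
  then show ?thesis
    using assms by (simp add: powr_def algebra_simps flip: exp_add)
qed

lemma q_gamma_gt_1:
  assumes "1 < q" "0 < x"
  shows "q_gamma q x = exp ((ln (q - 1) - exp_series (ln q) (log_coeff (ln q)) 1)
    + (- ln (q - 1) - ln q / 2) * x + ln q / 2 * x\<^sup>2 + exp_series (ln q) (log_coeff (ln q)) x)"
proof -
  have powr_eq: "q powr (- y) = exp (- (ln q * y))" for y
    using assms by (simp add: powr_def mult.commute)
  have "q_gamma q x = (q - 1) powr (1 - x) * q powr (x * (x - 1) / 2) *
      exp (exp_series (ln q) (log_coeff (ln q)) x - exp_series (ln q) (log_coeff (ln q)) 1)"
    using assms prodinf_q_gamma[of "ln q" x] unfolding q_gamma_def powr_eq by simp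
  then show ?thesis
    using assms by (simp add: powr_def algebra_simps power2_eq_square diff_divide_distrib
        flip: exp_add)
qed

text \<open>
  This covers \<open>q < 1\<close> with \<open>\<gamma> = 0\<close> and \<open>q > 1\<close> with \<open>\<gamma> = ln q\<close>; \<open>\<gamma>\<close> comes from the factor
  \<open>q powr (x * (x - 1) / 2)\<close> and vanishes from the third derivative of the logarithm on.
\<close>

lemma polygamma_of_log_q_gamma:
  assumes "disc_summable h" "0 < L"
    and gamma: "\<And>x. 0 < x \<Longrightarrow>
      q_gamma q x = exp (\<alpha> + \<beta> * x + \<gamma> / 2 * x\<^sup>2 + exp_series L h x)"
    and "0 < x"
  shows "q_trigamma q x = \<gamma> + exp_series L (deriv_coeff L (deriv_coeff L h)) x"
    and "q_tetragamma q x = exp_series L (deriv_coeff L (deriv_coeff L (deriv_coeff L h))) x"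
proof -
  note summ = assms(1) disc_summable_deriv_coeff
  note der = exp_series_has_derivative[OF _ \<open>0 < L\<close>]
  have transfer: "deriv g y = D"
    if "0 < y" "(f has_real_derivative D) (at y)" "\<And>z. 0 < z \<Longrightarrow> f z = g z" for f g D y
    using has_field_derivative_transform_within_open[OF that(2) open_greaterThan[of 0]] that
    by (auto intro: DERIV_imp_deriv)
  have di: "q_digamma q y = \<beta> + \<gamma> * y + exp_series L (deriv_coeff L h) y" if "0 < y" for y
  proof -
    let ?g = "\<lambda>x. exp (\<alpha> + \<beta> * x + \<gamma> / 2 * x\<^sup>2 + exp_series L h x)"
    have "(?g has_real_derivative ?g y * (\<beta> + \<gamma> * y + exp_series L (deriv_coeff L h) y)) (at y)"
      using that by (auto intro!: derivative_eq_intros der summ)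
    then have "deriv (q_gamma q) y = ?g y * (\<beta> + \<gamma> * y + exp_series L (deriv_coeff L h) y)"
      by (rule transfer[OF that]) (simp add: gamma)
    then show ?thesis by (simp add: q_digamma_def gamma[OF that])
  qed
  have tri: "q_trigamma q y = \<gamma> + exp_series L (deriv_coeff L (deriv_coeff L h)) y"
    if "0 < y" for y
    unfolding q_trigamma_def
  proof (rule transfer[OF that])
    show "((\<lambda>y. \<beta> + \<gamma> * y + exp_series L (deriv_coeff L h) y) has_real_derivative
        \<gamma> + exp_series L (deriv_coeff L (deriv_coeff L h)) y) (at y)"
      using that by (auto intro!: derivative_eq_intros der summ)
  qed (simp add: di)
  show "q_trigamma q x = \<gamma> + exp_series L (deriv_coeff L (deriv_coeff L h)) x"
    by (rule tri) fact
  show "q_tetragamma q x = exp_series L (deriv_coeff L (deriv_coeff L (deriv_coeff L h))) x"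
    unfolding q_tetragamma_def
  proof (rule transfer[OF \<open>0 < x\<close>])
    show "((\<lambda>y. \<gamma> + exp_series L (deriv_coeff L (deriv_coeff L h)) y) has_real_derivative
        exp_series L (deriv_coeff L (deriv_coeff L (deriv_coeff L h))) x) (at x)"
      using \<open>0 < x\<close> by (auto intro!: derivative_eq_intros der summ)
  qed (simp add: tri)
qed

section \<open>Complete monotonicity\<close>

text \<open>
  Adding the constant \<open>L\<close> turns the coefficients \<open>L\<^sup>2 * k / (1 - exp (- L) ^ k)\<close> of the series
  for \<open>\<psi>\<^sub>q'\<close> into \<open>L * todd (L * k)\<close> for all \<open>k\<close>, including \<open>k = 0\<close>.
\<close>

lemma log_coeff_deriv2:
  "deriv_coeff L (deriv_coeff L (log_coeff L)) k + (if k = 0 then L else 0) = L * todd (L * real k)"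
  if "0 < L"
proof (cases "k = 0")
  case False
  have "exp (- L) ^ k = exp (- (L * real k))"
    by (simp add: mult.commute flip: exp_of_nat_mult)
  with False that show ?thesis
    by (simp add: deriv_coeff_def log_coeff_def todd_def)
qed (simp add: deriv_coeff_def todd_def)

lemma completely_monotonic_square_plus_derivative:
  assumes L: "0 < L"
  defines "c \<equiv> deriv_coeff L (deriv_coeff L (log_coeff L))"
  shows "completely_monotonic_on {0<..}
    (\<lambda>x. (L + exp_series L c x)\<^sup>2 + exp_series L (deriv_coeff L c) x)"
proof -
  define b where "b k = L * todd (L * real k)" for k
  define e where "e n = (\<Sum>j\<le>n. b j * b (n - j)) + deriv_coeff L c n" for n
  define \<delta> where "\<delta> k = (if k = (0::nat) then L else 0)" for k
  have c: "disc_summable c"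
    unfolding c_def by (intro disc_summable_deriv_coeff disc_summable_log_coeff L)
  have \<delta>_sums: "(\<lambda>k. \<delta> k * t ^ k) sums L" for t
    using sums_mult[OF powser_sums_if[of 0 t], of L] unfolding \<delta>_def
    by (simp add: if_distrib if_distribR cong: if_cong)
  then have \<delta>: "disc_summable \<delta>" unfolding disc_summable_def by (auto simp: sums_iff)
  have b_eq: "b = (\<lambda>k. c k + \<delta> k)"
    using log_coeff_deriv2[OF L] by (auto simp: b_def c_def \<delta>_def)
  have b: "disc_summable b" unfolding b_eq by (intro disc_summable_add c \<delta>)
  have conv: "disc_summable (\<lambda>n. \<Sum>j\<le>n. b j * b (n - j))"
    by (intro disc_summable_Cauchy_product b)
  have nonneg: "0 \<le> e n" for n
  proof -
    (* b and c differ only at index 0, where the factor n vanishes. *)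
    have "deriv_coeff L c n = - (L * real n) * b n"
      by (cases "n = 0") (auto simp: deriv_coeff_def b_eq \<delta>_def)
    then have "e n = L\<^sup>2 * ((\<Sum>j\<le>n. todd (L * real j) * todd (L * real (n - j)))
        - real n * todd (L * real n))"
      by (simp add: e_def b_def power2_eq_square right_diff_distrib sum_distrib_left mult_ac)
    with todd_convolution_bound[of L n] L show ?thesis by simp
  qed
  have "(L + exp_series L c x)\<^sup>2 + exp_series L (deriv_coeff L c) x = exp_series L e x"
    if "x \<in> {0<..}" for x
  proof -
    have x: "0 < x" using that by simp
    have "exp_series L \<delta> x = L" using \<delta>_sums by (simp add: exp_series_def sums_iff)
    then have "L + exp_series L c x = exp_series L b x"
      unfolding b_eq by (simp add: exp_series_add[OF c \<delta> L x])
    then have "(L + exp_series L c x)\<^sup>2 = exp_series L (\<lambda>n. \<Sum>j\<le>n. b j * b (n - j)) x"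
      by (simp add: power2_eq_square exp_series_mult[OF b b L x])
    then show ?thesis
      unfolding e_def[abs_def]
      by (simp add: exp_series_add[OF conv disc_summable_deriv_coeff[OF c] L x])
  qed
  moreover have "completely_monotonic_on {0<..} (exp_series L e)"
    unfolding e_def[abs_def] using nonneg
    by (intro completely_monotonic_exp_series L disc_summable_add conv disc_summable_deriv_coeff c)
      (auto simp: e_def)
  ultimately show ?thesis by (rule completely_monotonic_on_cong[THEN iffD2])
qed

theorem theorem1p1:
  "(\<forall>q::real. 0 < q \<and> q < 1 \<longrightarrow>
      completely_monotonic_on {0<..} (\<lambda>x. (q_trigamma q x - ln q)\<^sup>2 + q_tetragamma q x)) \<and>
   (\<forall>q::real. q > 1 \<longrightarrow>
      completely_monotonic_on {0<..} (\<lambda>x. (q_trigamma q x)\<^sup>2 + q_tetragamma q x))"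
proof (intro conjI allI impI)
  fix q :: real assume q: "0 < q \<and> q < 1"
  then have L: "0 < - ln q" by simp
  note poly = polygamma_of_log_q_gamma[OF disc_summable_log_coeff[OF L] L q_gamma_less_1]
  show "completely_monotonic_on {0<..} (\<lambda>x. (q_trigamma q x - ln q)\<^sup>2 + q_tetragamma q x)"
    using completely_monotonic_square_plus_derivative[OF L] q
    by (subst completely_monotonic_on_cong) (auto simp: poly)
next
  fix q :: real assume q: "q > 1"
  then have L: "0 < ln q" by simp
  note poly = polygamma_of_log_q_gamma[OF disc_summable_log_coeff[OF L] L q_gamma_gt_1]
  show "completely_monotonic_on {0<..} (\<lambda>x. (q_trigamma q x)\<^sup>2 + q_tetragamma q x)"
    using completely_monotonic_square_plus_derivative[OF L] q
    by (subst completely_monotonic_on_cong) (auto simp: poly)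
qed

end
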